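(* Let $m=n$ be prime, let $f:\mathbb{Z}_n\to\mathbb{Z}_n$ be an $m$-cycle (a permutation that is a single cycle of length $m=n$), let $r\geq 2$, let $i_1,\dots,i_r\in\mathbb{Z}_m$ be nonzero and pairwise different, and put $\mathcal{I}=\{0,i_1,\dots,i_r\}\subseteq\mathbb{Z}_m$. Then the parity-check matrix $$H=\begin{pmatrix}1&1&\cdots&1\\ 1&f^{i_1}&\cdots&f^{i_r}\end{pmatrix}$$ has no $8$-cycles if and only if $\mathcal{I}$ is an $m$-$B_2$-set.
   Context: $\mathbb{Z}_n$ denotes the integers modulo $n$. A permutation $R$ of $\mathbb{Z}_n$ is identified with the $n\times n$ $0/1$ permutation matrix having entry $1$ at position $(a,c)$ iff $a=R(c)$; $1$ denotes the identity permutation (matrix). An array of permutations denotes the corresponding block matrix. Exponents of $f$ are taken modulo $m$. A set $\mathcal{I}\subseteq\mathbb{Z}_m$ is an $m$-$B_2$-set if for $p,q,s,t\in\mathcal{I}$ one has $p+q=s+t$ in $\mathbb{Z}_m$ iff $\{p,q\}=\{s,t\}$. Cycles in the matrix: a $2k$-cycle in $H$ ($k>1$) is a closed sequence of positions $(x_0,y_0),(x_1,y_0),(x_1,y_1),\dots,(x_{k-1},y_{k-1}),(x_0,y_{k-1}),(x_0,y_0)$ of $H$, obtained by alternately changing only the row or only the column, such that all these entries of $H$ equal $1$ and the $2k$ positions (other than the repeated first/last one) are pairwise distinct. *)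

theory Defs
  imports
    "HOL-Number_Theory.Cong"
    "HOL-Computational_Algebra.Primes"
    "HOL-Combinatorics.Permutations"
    "HOL-Combinatorics.Orbits"
    "Jordan_Normal_Form.Matrix"
begin

text \<open>
  The integers modulo \<open>n\<close> are represented throughout by their least residues \<open>{..<n}\<close>;
  equality in \<open>\<int>\<^sub>n\<close> of sums of residues is congruence modulo \<open>n\<close>.
\<close>

definition perm_mat :: "nat \<Rightarrow> (nat \<Rightarrow> nat) \<Rightarrow> 'a::zero_neq_one mat" where
  "perm_mat n R = mat n n (\<lambda>(a, c). if a = R c then 1 else 0)"

text \<open>Row \<open>x\<close> of the block matrix is row \<open>x mod n\<close> of block row \<open>x div n\<close>; similarly for columns.\<close>

definition perm_array_mat ::
  "nat \<Rightarrow> nat \<Rightarrow> nat \<Rightarrow> (nat \<Rightarrow> nat \<Rightarrow> nat \<Rightarrow> nat) \<Rightarrow> 'a::zero_neq_one mat" where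
  "perm_array_mat n J L P =
     mat (J * n) (L * n)
       (\<lambda>(x, y). perm_mat n (P (x div n) (y div n)) $$ (x mod n, y mod n))"

definition parity_check_mat ::
  "nat \<Rightarrow> nat \<Rightarrow> (nat \<Rightarrow> nat) \<Rightarrow> (nat \<Rightarrow> nat) \<Rightarrow> 'a::zero_neq_one mat" where
  "parity_check_mat n r f i =
     perm_array_mat n 2 (r + 1) (\<lambda>b c. if b = 0 \<or> c = 0 then id else f ^^ i c)"

definition B2_set :: "nat \<Rightarrow> nat set \<Rightarrow> bool" where
  "B2_set m I \<longleftrightarrow> I \<subseteq> {..<m} \<and>
     (\<forall>p\<in>I. \<forall>q\<in>I. \<forall>s\<in>I. \<forall>t\<in>I. [p + q = s + t] (mod m) \<longleftrightarrow> {p, q} = {s, t})"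

text \<open>
  The positions \<open>(x\<^sub>0,y\<^sub>0), (x\<^sub>1,y\<^sub>0), (x\<^sub>1,y\<^sub>1), \<dots>, (x\<^sub>k\<^sub>-\<^sub>1,y\<^sub>k\<^sub>-\<^sub>1), (x\<^sub>0,y\<^sub>k\<^sub>-\<^sub>1)\<close>,
  without the final repetition of \<open>(x\<^sub>0,y\<^sub>0)\<close>.
\<close>

definition cycle_positions :: "nat \<Rightarrow> (nat \<Rightarrow> nat) \<Rightarrow> (nat \<Rightarrow> nat) \<Rightarrow> (nat \<times> nat) list" where
  "cycle_positions k x y =
     concat (map (\<lambda>j. [(x j, y j), (x (Suc j mod k), y j)]) [0..<k])"

definition has_cycle :: "'a::zero_neq_one mat \<Rightarrow> nat \<Rightarrow> bool" where
  "has_cycle H l \<longleftrightarrow>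
     (\<exists>k x y. k > 1 \<and> l = 2 * k \<and>
        distinct (cycle_positions k x y) \<and>
        (\<forall>(a, b) \<in> set (cycle_positions k x y).
           a < dim_row H \<and> b < dim_col H \<and> H $$ (a, b) = 1))"

end

theory Submission imports Defs
begin

text \<open>
  Every column of \<open>H\<close> has exactly two entries \<open>1\<close>, one in each block row, so the column at offset
  \<open>a\<close> in block column \<open>c\<close> is an edge joining the top row \<open>a\<close> to the bottom row
  \<open>f\<^bsup>e c\<^esup> a\<close>, where \<open>e\<close> enumerates \<open>\<I>\<close>. An 8-cycle is thus a closed walk of four edges in which
  consecutive edges differ; as powers of the cycle \<open>f\<close> act freely modulo \<open>n\<close>, such a walk
  amounts to \<open>p + q \<equiv> s + t\<close> in \<open>\<I>\<close> with \<open>{p, q}\<close> and \<open>{s, t}\<close> disjoint.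
\<close>

text \<open>\<open>S\<close> is the orbit of \<open>s\<close>, and the first
  \<open>funpow_dist1 f s s\<close> powers list it without repetition. That return time is therefore
  \<open>card S\<close>, and exponents matter only modulo it.\<close>

lemma cyclic_on_funpow_eq_iff:
  assumes "cyclic_on f S" "s \<in> S"
  shows "(f ^^ a) s = (f ^^ b) s \<longleftrightarrow> [a = b] (mod card S)"
proof -
  let ?d = "funpow_dist1 f s s"
  have S: "S = orbit f s"
    using assms by (simp add: cyclic_on_alldef)
  then have s: "s \<in> orbit f s"
    using assms(2) by simp
  have inj: "inj_on (\<lambda>k. (f ^^ k) s) {0..<?d}"
    by (rule inj_on_funpow_dist1[OF s])
  have card: "card S = ?d"
    unfolding S orbit_conv_funpow_dist1[OF s] card_image[OF inj] by simp
  have "(f ^^ ?d) s = s"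
    by (rule funpow_dist1_prop[OF s])
  then have red: "(f ^^ (k mod ?d)) s = (f ^^ k) s" for k
    by (rule funpow_mod_eq)
  have "(f ^^ (a mod ?d)) s = (f ^^ (b mod ?d)) s \<longleftrightarrow> a mod ?d = b mod ?d"
    using inj_on_eq_iff[OF inj, of "a mod ?d" "b mod ?d"] by simp
  then show ?thesis
    unfolding red card cong_def .
qed

text \<open>If the two sums share a summand, it cancels, and congruent residues below
  \<open>m\<close> are equal. So a violation must have \<open>{p, q}\<close> and
  \<open>{s, t}\<close> disjoint, which is the form an 8-cycle delivers: consecutive edges carry
  different exponents.\<close>

lemma B2_set_iff:
  assumes "I \<subseteq> {..<m}"
  shows "B2_set m I \<longleftrightarrow>
    \<not> (\<exists>p\<in>I. \<exists>q\<in>I. \<exists>s\<in>I. \<exists>t\<in>I. [p + q = s + t] (mod m) \<and> p \<noteq> s \<and> p \<noteq> t \<and> q \<noteq> s \<and> q \<noteq> t)"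
    (is "_ \<longleftrightarrow> \<not> ?R")
proof
  assume "B2_set m I"
  then show "\<not> ?R"
    unfolding B2_set_def by blast
next
  assume nR: "\<not> ?R"
  have eq: "u = v" if "u \<in> I" "v \<in> I" "[u = v] (mod m)" for u v
    using that assms cong_less_modulus_unique_nat by blast
  have "{p, q} = {s, t}"
    if I: "p \<in> I" "q \<in> I" "s \<in> I" "t \<in> I" and c: "[p + q = s + t] (mod m)" for p q s t
  proof -
    consider "p = s" | "p = t" | "q = s" | "q = t"
      using nR I c by blast
    then show ?thesis
    proof cases
      case 1
      then have "q = t" using c I by (intro eq) (simp_all add: cong_add_lcancel_nat)
      with 1 show ?thesis by simp
    next
      case 2
      then have "q = s" using c I by (intro eq) (simp_all add: add.commute[of s] cong_add_lcancel_nat)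
      with 2 show ?thesis by blast
    next
      case 3
      then have "p = t" using c I by (intro eq) (simp_all add: add.commute[of p] cong_add_lcancel_nat)
      with 3 show ?thesis by blast
    next
      case 4
      then have "p = s" using c I by (intro eq) (simp_all add: cong_add_rcancel_nat)
      with 4 show ?thesis by simp
    qed
  qed
  moreover have "[p + q = s + t] (mod m)" if "{p, q} = {s, t}" for p q s t
    using that by (auto simp: doubleton_eq_iff add.commute)
  ultimately show "B2_set m I"
    unfolding B2_set_def using assms by blast
qed

text \<open>Only the values of \<open>x\<close> and \<open>y\<close> at 0, 1, 2, 3 enter, with the
  index wrapping from 3 to 0, so eight numbers can replace the two functions.\<close>

lemma has_cycle_8_iff:
  "has_cycle H 8 \<longleftrightarrow>
    (\<exists>x0 x1 x2 x3 y0 y1 y2 y3.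
      let ps = [(x0, y0), (x1, y0), (x1, y1), (x2, y1), (x2, y2), (x3, y2), (x3, y3), (x0, y3)]
      in distinct ps \<and> (\<forall>(a, b) \<in> set ps. a < dim_row H \<and> b < dim_col H \<and> H $$ (a, b) = 1))"
    (is "?L \<longleftrightarrow> ?R")
proof -
  have positions: "cycle_positions 4 x y =
      [(x 0, y 0), (x 1, y 0), (x 1, y 1), (x 2, y 1), (x 2, y 2), (x 3, y 2), (x 3, y 3), (x 0, y 3)]"
    for x y :: "nat \<Rightarrow> nat"
  proof -
    have "[0..<4] = [0, 1, 2, 3::nat]"
      by (simp add: upt_rec)
    then show ?thesis
      by (simp add: cycle_positions_def) (simp add: numeral_2_eq_2)
  qed
  have "?L \<longleftrightarrow> (\<exists>x y. distinct (cycle_positions 4 x y) \<and>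
      (\<forall>(a, b) \<in> set (cycle_positions 4 x y). a < dim_row H \<and> b < dim_col H \<and> H $$ (a, b) = 1))"
    (is "_ \<longleftrightarrow> (\<exists>x y. ?P x y)")
  proof
    assume ?L
    then obtain k x y where *: "8 = 2 * k" "distinct (cycle_positions k x y)"
        "\<forall>(a, b) \<in> set (cycle_positions k x y). a < dim_row H \<and> b < dim_col H \<and> H $$ (a, b) = 1"
      unfolding has_cycle_def by blast
    from *(1) have "k = 4" by simp
    with * show "\<exists>x y. ?P x y" by blast
  next
    assume "\<exists>x y. ?P x y"
    then show ?L
      unfolding has_cycle_def by (intro exI[of _ "4::nat"]) auto
  qed
  also have "\<dots> \<longleftrightarrow> ?R"
  proof
    assume "\<exists>x y. ?P x y"
    then show ?R
      unfolding positions Let_def by blast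
  next
    assume ?R
    then obtain x0 x1 x2 x3 y0 y1 y2 y3 where
      *: "let ps = [(x0, y0), (x1, y0), (x1, y1), (x2, y1), (x2, y2), (x3, y2), (x3, y3), (x0, y3)]
        in distinct ps \<and> (\<forall>(a, b) \<in> set ps. a < dim_row H \<and> b < dim_col H \<and> H $$ (a, b) = 1)"
      by blast
    have nth: "[a, b, c, d] ! 0 = a" "[a, b, c, d] ! 1 = b" "[a, b, c, d] ! 2 = c" "[a, b, c, d] ! 3 = d"
      for a b c d :: nat
      by simp_all
    have "?P (\<lambda>j. [x0, x1, x2, x3] ! j) (\<lambda>j. [y0, y1, y2, y3] ! j)"
      using * unfolding positions nth Let_def .
    then show "\<exists>x y. ?P x y" by blast
  qed
  finally show ?thesis .
qed

lemma parity_check_mat_entry: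
  assumes "n > 0" "x < 2 * n" "y < (r + 1) * n"
  shows "(parity_check_mat n r f i $$ (x, y) :: 'a::zero_neq_one) = 1 \<longleftrightarrow>
    x mod n = (if x div n = 0 then y mod n else (f ^^ (if y div n = 0 then 0 else i (y div n))) (y mod n))"
  using assms by (auto simp: parity_check_mat_def perm_array_mat_def perm_mat_def)

text \<open>Writing the identity block as the power with exponent \<open>e 0 = 0\<close> treats all
  bottom blocks alike.\<close>

lemma no_8_cycle_parity_check_mat_iff:
  fixes n r :: nat and f :: "nat \<Rightarrow> nat" and i e :: "nat \<Rightarrow> nat"
    and H :: "'a::zero_neq_one mat"
  assumes n: "n > 0" and perm: "f permutes {..<n}" and cyc: "cyclic_on f {..<n}"
    and e_def: "e = (\<lambda>c. if c = 0 then 0 else i c)"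
    and e_lt: "e ` {..r} \<subseteq> {..<n}" and inj: "inj_on e {..r}"
    and H: "H = parity_check_mat n r f i"
  shows "\<not> has_cycle H 8 \<longleftrightarrow> B2_set n (e ` {..r})"
proof -
  define E where "E x y \<longleftrightarrow> x < dim_row H \<and> y < dim_col H \<and> H $$ (x, y) = 1" for x y
  have E_iff: "E x y \<longleftrightarrow> x < 2 * n \<and> y < (r + 1) * n \<and>
      x mod n = (if x div n = 0 then y mod n else (f ^^ e (y div n)) (y mod n))" for x y
  proof -
    have "dim_row H = 2 * n" "dim_col H = (r + 1) * n"
      by (simp_all add: H parity_check_mat_def perm_array_mat_def)
    then show ?thesis
      unfolding E_def H e_def using parity_check_mat_entry[OF n, where 'a = 'a] by auto
  qed
  have f_eq: "(f ^^ a) s = (f ^^ b) s \<longleftrightarrow> [a = b] (mod n)" if "s < n" for a b s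
    using cyclic_on_funpow_eq_iff[OF cyc, of s a b] that by simp
  have f_lt: "(f ^^ a) s < n" if "s < n" for a s
    using cyclic_on_funpow_in[OF cyc, of s a] that by simp
  have col_unique: "y = y'" if "y mod n = y' mod n" "y div n = y' div n" for y y'
    using that by (metis div_mult_mod_eq)
  have row_div: "x div n = 0 \<or> x div n = 1" if "x < 2 * n" for x
    using that less_mult_imp_div_less[of x 2 n] by linarith
  have E_top: "x = y mod n" if "E x y" "x div n = 0" for x y
    using that n by (auto simp: E_iff div_eq_0_iff)
  have E_bot: "x mod n = (f ^^ e (y div n)) (y mod n)" if "E x y" "x div n = 1" for x y
    using that by (auto simp: E_iff)
  have E_le: "y div n \<le> r" if "E x y" for x y
    using that less_mult_imp_div_less[of y "r + 1" n] by (auto simp: E_iff)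
  \<comment> \<open>A permutation block has a single 1 in each column, so two different 1s of a
    column of \<open>H\<close> lie in different block rows.\<close>
  have E_alt: "x div n = 0 \<and> x' div n = 1 \<or> x div n = 1 \<and> x' div n = 0"
    if "E x y" "E x' y" "x \<noteq> x'" for x x' y
  proof -
    have "x = x'" if "x div n = x' div n"
    proof (rule col_unique[OF _ that])
      show "x mod n = x' mod n"
        using \<open>E x y\<close> \<open>E x' y\<close> that by (simp add: E_iff)
    qed
    then show ?thesis
      using row_div[of x] row_div[of x'] that by (auto simp: E_iff)
  qed

  \<comment> \<open>Powers of \<open>f\<close> are injective. Read contrapositively, different edges
    at one vertex carry different exponents.\<close>
  have E_inj: "y = y'" if "E x y" "E x y'" "e (y div n) = e (y' div n)" for x y y'
  proof -
    have "y div n = y' div n"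
      using inj_onD[OF inj that(3)] E_le that by simp
    moreover have "y mod n = y' mod n"
      using that row_div[of x] inj_fn[OF permutes_inj[OF perm], of "e (y div n)"]
      by (auto simp: E_iff dest: injD split: if_splits)
    ultimately show ?thesis
      using col_unique by blast
  qed
  \<comment> \<open>A closed walk from a top row applies exponents \<open>p\<close> and
    \<open>q\<close> going down and undoes \<open>s\<close> and \<open>t\<close> going up.\<close>
  have walk: "\<not> B2_set n (e ` {..r})"
    if E: "E x0 y0" "E x1 y0" "E x1 y1" "E x2 y1" "E x2 y2" "E x3 y2" "E x3 y3" "E x0 y3"
      and ne: "y0 \<noteq> y1" "y1 \<noteq> y2" "y2 \<noteq> y3" "y3 \<noteq> y0"
      and x: "x0 div n = 0" "x1 div n = 1" "x2 div n = 0" "x3 div n = 1"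
    for x0 x1 x2 x3 y0 y1 y2 y3
  proof -
    define p s q t where "p = e (y0 div n)" and "s = e (y1 div n)"
      and "q = e (y2 div n)" and "t = e (y3 div n)"
    note defs = p_def s_def q_def t_def
    have top: "y0 mod n = x0" "y3 mod n = x0" "y1 mod n = x2" "y2 mod n = x2"
      using E x E_top by metis+
    have lt: "x0 < n" "x2 < n"
      using top n by (metis mod_less_divisor)+
    have bot: "x1 mod n = (f ^^ p) x0" "x1 mod n = (f ^^ s) x2"
      "x3 mod n = (f ^^ q) x2" "x3 mod n = (f ^^ t) x0"
      using E x E_bot top unfolding defs by metis+
    have "p \<noteq> s" "p \<noteq> t" "q \<noteq> s" "q \<noteq> t"
      unfolding defs using E_inj E ne by metis+
    moreover have "[p + q = s + t] (mod n)"
    proof -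
      \<comment> \<open>Commuting powers of \<open>f\<close> lets both sides be compared at the one
        point \<open>x0\<close>, where equality of powers is congruence of exponents.\<close>
      have "(f ^^ (q + p)) x0 = (f ^^ q) ((f ^^ s) x2)"
        using bot by (simp add: funpow_add)
      also have "\<dots> = (f ^^ s) ((f ^^ q) x2)"
        by (metis add.commute comp_apply funpow_add)
      also have "\<dots> = (f ^^ (s + t)) x0"
        using bot by (simp add: funpow_add)
      finally show ?thesis
        using f_eq[OF lt(1)] by (simp add: add.commute)
    qed
    moreover have "p \<in> e ` {..r}" "q \<in> e ` {..r}" "s \<in> e ` {..r}" "t \<in> e ` {..r}"
      unfolding defs using E E_le by blast+
    ultimately show ?thesis
      unfolding B2_set_iff[OF e_lt] by blast
  qed

  have "has_cycle H 8 \<longleftrightarrow> \<not> B2_set n (e ` {..r})"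
  proof
    assume "has_cycle H 8"
    then obtain x0 x1 x2 x3 y0 y1 y2 y3 where
      dist: "distinct [(x0, y0), (x1, y0), (x1, y1), (x2, y1), (x2, y2), (x3, y2), (x3, y3), (x0, y3)]"
      and ones: "\<forall>(a, b) \<in> set [(x0, y0), (x1, y0), (x1, y1), (x2, y1), (x2, y2), (x3, y2), (x3, y3), (x0, y3)]. E a b"
      unfolding has_cycle_8_iff Let_def E_def[symmetric] by blast
    have E: "E x0 y0" "E x1 y0" "E x1 y1" "E x2 y1" "E x2 y2" "E x3 y2" "E x3 y3" "E x0 y3"
      using ones by simp_all
    \<comment> \<open>Neighbouring positions share one coordinate, so they must differ in the
      other.\<close>
    have ne: "x0 \<noteq> x1" "x1 \<noteq> x2" "x2 \<noteq> x3" "x3 \<noteq> x0"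
        "y0 \<noteq> y1" "y1 \<noteq> y2" "y2 \<noteq> y3" "y3 \<noteq> y0"
      using dist by - (rule notI, hypsubst, simp)+
    have alt: "x0 div n = 0 \<and> x1 div n = 1 \<and> x2 div n = 0 \<and> x3 div n = 1 \<or>
        x1 div n = 0 \<and> x2 div n = 1 \<and> x3 div n = 0 \<and> x0 div n = 1"
      using E_alt[OF E(1,2) ne(1)] E_alt[OF E(3,4) ne(2)] E_alt[OF E(5,6) ne(3)] by auto
    then show "\<not> B2_set n (e ` {..r})"
    proof
      assume "x0 div n = 0 \<and> x1 div n = 1 \<and> x2 div n = 0 \<and> x3 div n = 1"
      then show ?thesis
        using walk[of x0 y0 x1 y1 x2 y2 x3 y3] E ne by simp
    next
      \<comment> \<open>Rotating the cycle by one row makes it start in the top block row.\<close>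
      assume "x1 div n = 0 \<and> x2 div n = 1 \<and> x3 div n = 0 \<and> x0 div n = 1"
      then show ?thesis
        using walk[of x1 y1 x2 y2 x3 y3 x0 y0] E ne by simp
    qed
  next
    assume "\<not> B2_set n (e ` {..r})"
    then obtain cp cq cs ct where c: "cp \<le> r" "cq \<le> r" "cs \<le> r" "ct \<le> r"
      and sum: "[e cp + e cq = e cs + e ct] (mod n)"
      and ne: "e cp \<noteq> e cs" "e cp \<noteq> e ct" "e cq \<noteq> e cs" "e cq \<noteq> e ct"
      unfolding B2_set_iff[OF e_lt] by auto
    have elt: "e c < n" if "c \<le> r" for c
      using e_lt that by auto
    have cong_eq: "e c = e c'" if "[e c = e c'] (mod n)" "c \<le> r" "c' \<le> r" for c c'
      using that elt by (auto simp: cong_def)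
    \<comment> \<open>Top offsets are \<open>a\<close>, \<open>a'\<close> and bottom offsets
      \<open>b\<close>, \<open>b'\<close>. Starting from 0, go down by \<open>e cp\<close> and back
      up by \<open>e cs\<close>; adding \<open>n - e cs\<close> is subtraction modulo
      \<open>n\<close> without truncation.\<close>
    define a b a' b' where "a = (0::nat)" and "b = (f ^^ e cp) a"
      and "a' = (f ^^ (e cp + (n - e cs))) a" and "b' = (f ^^ e ct) a"
    have a: "a < n" using n by (simp add: a_def)
    have lt: "b < n" "a' < n" "b' < n"
      unfolding b_def a'_def b'_def using f_lt[OF a] by simp_all
    have b_eq: "b = (f ^^ e cs) a'"
    proof -
      have "[e cp = e cs + (e cp + (n - e cs))] (mod n)"
        using elt[OF c(3)] by (simp add: cong_def)
      then have "(f ^^ e cp) a = (f ^^ (e cs + (e cp + (n - e cs)))) a"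
        using f_eq[OF a] by blast
      then show ?thesis
        unfolding b_def a'_def funpow_add[of "e cs"] by simp
    qed
    \<comment> \<open>Here the assumed congruence closes the walk: \<open>e cp - e cs + e cq\<close>
      is \<open>e ct\<close> modulo \<open>n\<close>.\<close>
    have b'_eq: "b' = (f ^^ e cq) a'"
    proof -
      have "(f ^^ e cq) a' = (f ^^ (e cq + (e cp + (n - e cs)))) a"
        unfolding a'_def funpow_add[of "e cq"] by simp
      moreover have "[e cq + (e cp + (n - e cs)) = e ct] (mod n)"
      proof -
        have "[(e cp + e cq) + (n - e cs) = (e cs + e ct) + (n - e cs)] (mod n)"
          using sum by (simp add: cong_add_rcancel_nat)
        moreover have "(e cs + e ct) + (n - e cs) = e ct + n"
          using elt[OF c(3)] by simp
        ultimately show ?thesis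
          by (simp add: cong_def ac_simps)
      qed
      ultimately show ?thesis
        using f_eq[OF a] unfolding b'_def by metis
    qed
    have "a \<noteq> a'"
    proof
      assume "a = a'"
      then have "(f ^^ e cp) a = (f ^^ e cs) a" using b_eq b_def by simp
      then show False using f_eq[OF a] cong_eq c ne by blast
    qed
    have "b \<noteq> b'"
      unfolding b_def b'_def using f_eq[OF a] cong_eq c ne by blast
    have Etop: "E d (k * n + d)" and Ebot: "E (n + (f ^^ e k) d) (k * n + d)"
      if "d < n" "k \<le> r" for d k
    proof -
      have "k * n + d < (r + 1) * n"
        using that(1) mult_le_mono1[OF that(2), of n] unfolding add_mult_distrib by linarith
      moreover have "(f ^^ e k) d < n" using f_lt that by simp
      ultimately show "E d (k * n + d)" "E (n + (f ^^ e k) d) (k * n + d)"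
        unfolding E_iff using that n by simp_all
    qed
    let ?y0 = "cp * n + a" and ?y1 = "cs * n + a'" and ?y2 = "cq * n + a'" and ?y3 = "ct * n + a"
    \<comment> \<open>Division by \<open>n\<close> recovers the block column, and different
      exponents come from different block columns.\<close>
    have col: "k * n + d \<noteq> k' * n + d'"
      if "e k \<noteq> e k'" "d < n" "d' < n" for k k' d d'
    proof
      assume "k * n + d = k' * n + d'"
      then have "(k * n + d) div n = (k' * n + d') div n" by simp
      then show False using that by simp
    qed
    have y_ne: "?y0 \<noteq> ?y1" "?y2 \<noteq> ?y1" "?y2 \<noteq> ?y3" "?y0 \<noteq> ?y3"
      using col ne a lt by blast+
    have bot: "E (n + b) ?y0" "E (n + b) ?y1" "E (n + b') ?y2" "E (n + b') ?y3"
      using Ebot[of a cp] Ebot[of a' cs] Ebot[of a' cq] Ebot[of a ct] a lt c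
      by (simp_all only: b_eq[symmetric] b'_eq[symmetric] b_def[symmetric] b'_def[symmetric])
    have top: "E a ?y0" "E a ?y3" "E a' ?y1" "E a' ?y2"
      using Etop a lt c by blast+
    let ?ps = "[(a, ?y0), (n + b, ?y0), (n + b, ?y1), (a', ?y1), (a', ?y2), (n + b', ?y2), (n + b', ?y3), (a, ?y3)]"
    \<comment> \<open>With four different rows, each row holds just two of the positions, and these
      lie in cyclically adjacent columns.\<close>
    have dist: "distinct [(x0, z0), (x1, z0), (x1, z1), (x2, z1), (x2, z2), (x3, z2), (x3, z3), (x0, z3)]"
      if "distinct [x0, x1, x2, x3]" "z0 \<noteq> z1" "z2 \<noteq> z1" "z2 \<noteq> z3" "z0 \<noteq> z3"
      for x0 x1 x2 x3 z0 z1 z2 z3 :: nat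
      using that by auto
    have "distinct [a, n + b, a', n + b']"
      using \<open>a \<noteq> a'\<close> \<open>b \<noteq> b'\<close> a lt by simp
    then have "distinct ?ps"
      using y_ne by (rule dist)
    moreover have "\<forall>(x, y) \<in> set ?ps. E x y"
      using bot top by simp
    ultimately show "has_cycle H 8"
      unfolding has_cycle_8_iff Let_def E_def[symmetric] by blast
  qed
  then show ?thesis by blast
qed

theorem corollary2:
  fixes m n r :: nat and f :: "nat \<Rightarrow> nat" and i :: "nat \<Rightarrow> nat"
    and H :: "'a::zero_neq_one mat"
  assumes "prime m" and "m = n"
    and "f permutes {..<n}" and "cyclic_on f {..<n}"
    and "r \<ge> 2"
    and "\<And>j. j \<in> {1..r} \<Longrightarrow> i j < m \<and> i j \<noteq> 0"
    and "inj_on i {1..r}"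
    and "H = parity_check_mat n r f i"
  shows "\<not> has_cycle H 8 \<longleftrightarrow> B2_set m (insert 0 (i ` {1..r}))"
proof -
  define e where "e = (\<lambda>c. if c = 0 then 0 else i c)"
  have n: "n > 0"
    using assms(1,2) prime_gt_0_nat by blast
  have split: "{..r} = insert 0 {1..r}"
    by auto
  have "e ` {1..r} = i ` {1..r}"
    by (intro image_cong) (auto simp: e_def)
  then have image: "e ` {..r} = insert 0 (i ` {1..r})"
    unfolding split image_insert by (simp only: e_def if_True refl)
  \<comment> \<open>The values \<open>i j\<close> are nonzero, which separates index 0, where
    \<open>e\<close> is 0, from the others.\<close>
  have "inj_on e {..r}"
  proof (rule inj_onI)
    fix c d assume "c \<in> {..r}" "d \<in> {..r}" "e c = e d"
    then show "c = d"
      using assms(6)[of c] assms(6)[of d] inj_onD[OF assms(7), of c d]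
      by (cases "c = 0"; cases "d = 0") (auto simp: e_def)
  qed
  moreover have "e ` {..r} \<subseteq> {..<n}"
    unfolding image using n assms(2,6) by auto
  ultimately show ?thesis
    using no_8_cycle_parity_check_mat_iff[OF n assms(3,4) e_def _ _ assms(8)] image assms(2) by simp
qed

end
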